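(* Let $a$, $b$, $n$ be complex parameters with $n\notin\{0,-1,-2,\ldots\}$ and $a+2n\notin\{0,-1,-2,\ldots\}$, and let $$ f(n)=\sum_{k=0}^{\infty}\frac{(a)_k\,(b)_k}{(n)_k\,(a+2n)_k}. $$ If the series $f(n)$ and $f(n+1)$ converge, and $(b-3n-1)(b-3n)(b-3n+1)\neq 0$, then the recursion $$ f(n)=g_1(n)+g_2(n)\,f(n+1) $$ holds, where $$ g_2(n) = \frac{2(2n+1)(a-n)(n-b)(a-b+2n)(a-b+2n+1)}{(a+2n)(a+2n+1)(b-3n-1)(b-3n)(b-3n+1)} $$ and $$ g_1(n) = \frac{N(a,b,n)}{(b-3n-1)(b-3n)(b-3n+1)(a+2n)}, $$ with $$ N(a,b,n) = a(b-1)b-\bigl(2a^2-2(b-1)b+a(-3+b(3+b))\bigr)n-2\bigl(-3+a+2a^2-8ab+b(3+4b)\bigr)n^2+(4-31a+38b)n^3-46n^4. $$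
   Context: For a complex number $x$ and an integer $k\ge 0$, $(x)_k = x(x+1)\cdots(x+k-1)$ denotes the Pochhammer symbol (rising factorial), with $(x)_0=1$. Here $f(n+1)$ is the same series with $n$ replaced by $n+1$ everywhere (so $a+2n$ becomes $a+2n+2$) and with $a,b$ unchanged, i.e. $f(n+1)=\sum_{k\ge 0}(a)_k(b)_k/\bigl((n+1)_k(a+2n+2)_k\bigr)$. *)

theory Defs
  imports "HOL-Analysis.Analysis"
begin

definition f_term :: "complex \<Rightarrow> complex \<Rightarrow> complex \<Rightarrow> nat \<Rightarrow> complex" where
  "f_term a b n k =
     (pochhammer a k * pochhammer b k) / (pochhammer n k * pochhammer (a + 2 * n) k)"

text \<open>The third parameter enters both denominator factors, so that \<open>f_series a b (n + 1)\<close> is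
  the series with \<open>a\<close> and \<open>b\<close> unchanged and \<open>a + 2n\<close> replaced by \<open>a + 2n + 2\<close>.\<close>

definition f_series :: "complex \<Rightarrow> complex \<Rightarrow> complex \<Rightarrow> complex" where
  "f_series a b n = (\<Sum>k. f_term a b n k)"

definition N_poly :: "complex \<Rightarrow> complex \<Rightarrow> complex \<Rightarrow> complex" where
  "N_poly a b n =
     a * (b - 1) * b
     - (2 * a^2 - 2 * (b - 1) * b + a * (-3 + b * (3 + b))) * n
     - 2 * (-3 + a + 2 * a^2 - 8 * a * b + b * (3 + 4 * b)) * n^2
     + (4 - 31 * a + 38 * b) * n^3
     - 46 * n^4"

definition g1 :: "complex \<Rightarrow> complex \<Rightarrow> complex \<Rightarrow> complex" where
  "g1 a b n =
     N_poly a b n / ((b - 3 * n - 1) * (b - 3 * n) * (b - 3 * n + 1) * (a + 2 * n))"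

definition g2 :: "complex \<Rightarrow> complex \<Rightarrow> complex \<Rightarrow> complex" where
  "g2 a b n =
     (2 * (2 * n + 1) * (a - n) * (n - b) * (a - b + 2 * n) * (a - b + 2 * n + 1)) /
     ((a + 2 * n) * (a + 2 * n + 1) * (b - 3 * n - 1) * (b - 3 * n) * (b - 3 * n + 1))"

end

theory Submission
  imports Defs
begin

text \<open>
  The recursion is an instance of creative telescoping.  Put \<open>c = a + 2 * n\<close>, \<open>e = b - 3 * n\<close> and
  \<open>D = (e - 1) * e * (e + 1)\<close>.  The quadratic polynomial \<open>q = cert_poly a b n\<close> is chosen so that
  \<open>G k = q k / (D * (c + k)) * f_term a b n k\<close> satisfies
  \<open>G (k + 1) - G k = f_term a b n k - g2 a b n * f_term a b (n + 1) k\<close> (\<open>cert_telescopes\<close>).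
  After division by the common hypergeometric term this is a polynomial identity in \<open>k\<close> of degree
  three.  Its four coefficients determine the three coefficients of \<open>q\<close> together with \<open>g2 a b n\<close>
  (Gosper's method with an undetermined parameter).  The constant term of \<open>q\<close> turns out to be
  \<open>- N_poly a b n\<close>, so that \<open>- G 0 = g1 a b n\<close>, and summing over \<open>k\<close> gives the recursion with the
  additional summand \<open>lim G\<close> on the right.

  It remains to see that \<open>lim G = 0\<close>.  The limit exists because both series converge.  The rational
  factor of \<open>G k\<close> grows like \<open>k / (e + 1)\<close>, so \<open>k * f_term a b n k\<close> has a limit as well, and
  such a limit must be zero: otherwise the series \<open>f_series a b n\<close> would diverge by comparison
  with the harmonic series (\<open>summable_imp_limit_of_nat_mult_eq_0\<close>).
\<close>

section \<open>A limit criterion from the harmonic series\<close>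

text \<open>
  A nonzero limit \<open>L\<close> would give \<open>Re (t k / L) \<ge> 1 / (2 * k)\<close> for all large \<open>k\<close>.  The real part of
  \<open>t k / L\<close> is compared, and not the norm, because \<open>t\<close> may converge only conditionally.
\<close>

lemma summable_imp_limit_of_nat_mult_eq_0:
  fixes t :: "nat \<Rightarrow> complex"
  assumes t: "summable t" and lim: "(\<lambda>k. of_nat k * t k) \<longlonglongrightarrow> L"
  shows "L = 0"
proof (rule ccontr)
  assume L: "L \<noteq> 0"
  have "(\<lambda>k. of_nat k * t k / L) \<longlonglongrightarrow> L / L"
    using L by (intro tendsto_divide lim tendsto_const)
  then have "(\<lambda>k. Re (of_nat k * t k / L)) \<longlonglongrightarrow> Re 1"
    using L by (intro tendsto_Re) simp
  moreover have "Re (of_nat k * t k / L) = real k * Re (t k / L)" for k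
    by (simp del: times_divide_eq_right add: times_divide_eq_right[symmetric])
  ultimately have "(\<lambda>k. real k * Re (t k / L)) \<longlonglongrightarrow> 1"
    by simp
  then have "eventually (\<lambda>k. real k * Re (t k / L) > 1 / 2) sequentially"
    by (rule order_tendstoD) simp
  then have ev: "eventually (\<lambda>k. norm (1 / 2 * inverse (real k)) \<le> Re (t k / L)) sequentially"
    using eventually_gt_at_top[of 0] by eventually_elim (auto simp: field_simps)
  have "summable (\<lambda>k. Re (t k / L))"
    using t by (intro summable_Re summable_divide)
  then have "summable (\<lambda>k. 1 / 2 * inverse (real k))"
    using ev by (rule summable_comparison_test_ev[rotated])
  then show False
    using not_summable_harmonic[where 'a = real] by (simp add: summable_cmult_iff)
qed

section \<open>Contiguous terms of the series\<close>

lemma add_of_nat_nonzero: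
  fixes z :: complex
  assumes "z \<notin> \<int>\<^sub>\<le>\<^sub>0"
  shows "z + of_nat k \<noteq> 0"
  using assms by (metis add_eq_0_iff2 minus_of_nat_in_nonpos_Ints)

lemma f_term_Suc:
  "f_term a b n (Suc k) =
     f_term a b n k * ((a + of_nat k) * (b + of_nat k)) /
       ((n + of_nat k) * (a + 2 * n + of_nat k))"
  by (simp add: f_term_def pochhammer_Suc mult_ac)

text \<open>
  Both shifts of a parameter come from \<open>z * pochhammer (z + 1) k = pochhammer z k * (z + k)\<close>, used
  once for \<open>z = n\<close> and twice for the parameter \<open>a + 2 * n\<close>, which moves by two.
\<close>

lemma f_term_plus_one:
  assumes n: "n \<notin> \<int>\<^sub>\<le>\<^sub>0" and c: "a + 2 * n \<notin> \<int>\<^sub>\<le>\<^sub>0"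
  defines "c \<equiv> a + 2 * n"
  shows "f_term a b (n + 1) k =
     f_term a b n k * (n * c * (c + 1)) /
       ((n + of_nat k) * (c + of_nat k) * (c + of_nat k + 1))"
proof -
  have shift: "z * pochhammer (z + 1) k = pochhammer z k * (z + of_nat k)" for z :: complex
    using pochhammer_rec[of z k] pochhammer_Suc[of z k] by simp
  have nz: "n + of_nat j \<noteq> 0" "c + of_nat j \<noteq> 0" for j
    using add_of_nat_nonzero[OF n] add_of_nat_nonzero[OF c] by (auto simp: c_def)
  have n0: "n \<noteq> 0" and c0: "c \<noteq> 0" and c1: "c + 1 \<noteq> 0" and c1k: "c + of_nat k + 1 \<noteq> 0"
    using nz(1)[of 0] nz(2)[of 0] nz(2)[of 1] nz(2)[of "Suc k"] by (auto simp: add_ac)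
  have n': "pochhammer (n + 1) k = pochhammer n k * (n + of_nat k) / n"
    using shift[of n] n0 by (simp add: field_simps)
  have c': "pochhammer (c + 1) k = pochhammer c k * (c + of_nat k) / c"
    using shift[of c] c0 by (simp add: field_simps)
  have "pochhammer (c + 1 + 1) k = pochhammer (c + 1) k * (c + 1 + of_nat k) / (c + 1)"
    using shift[of "c + 1"] c1 by (simp add: field_simps)
  also have "c + 1 + 1 = a + 2 * (n + 1)"
    by (simp add: c_def)
  finally have "pochhammer (a + 2 * (n + 1)) k =
      pochhammer c k * (c + of_nat k) * (c + of_nat k + 1) / (c * (c + 1))"
    unfolding c' by (simp add: add_ac mult_ac)
  then show ?thesis
    by (simp add: f_term_def n' mult.assoc mult.left_commute flip: c_def)
qed

section \<open>The certificate\<close>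

text \<open>
  The coefficients solve the linear system that telescoping imposes, cleared of its determinant:
  with \<open>e = b - 3 * n\<close>, comparison of the coefficients of \<open>k ^ 3\<close>, \<open>k ^ 2\<close> and \<open>k\<close> divides in turn by
  \<open>e + 1\<close>, \<open>e\<close> and \<open>e - 1\<close>.
\<close>

definition cert_poly :: "complex \<Rightarrow> complex \<Rightarrow> complex \<Rightarrow> complex \<Rightarrow> complex" where
  "cert_poly a b n x =
     (b - 3 * n - 1) * (b - 3 * n) * x^2
     + (b - 3 * n - 1) *
         ((2 * a + 5 * n + 1) * (b - 3 * n + 1)
          - (1 + 2 * a + 2 * b + a * b - n * (a + 2 * n + 1))) * x
     - N_poly a b n"

text \<open>
  This is the telescoping relation after multiplication by
  \<open>D * (n + x) * (a + 2 * n + x) * (a + 2 * n + x + 1)\<close> and division by \<open>f_term a b n x\<close>.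
  The last summand is the contribution of \<open>g2\<close>: its numerator, times the factor \<open>n\<close> left over from
  the ratio of \<open>f_term a b (n + 1)\<close> to \<open>f_term a b n\<close>.
\<close>

lemma cert_poly_identity:
  "(a + x) * (b + x) * cert_poly a b n (x + 1)
     - (n + x) * (a + 2 * n + x + 1) * cert_poly a b n x =
   (b - 3 * n - 1) * (b - 3 * n) * (b - 3 * n + 1)
       * ((n + x) * (a + 2 * n + x) * (a + 2 * n + x + 1))
     - n * (2 * (2 * n + 1) * (a - n) * (n - b) * (a - b + 2 * n) * (a - b + 2 * n + 1))"
  unfolding cert_poly_def N_poly_def by algebra

definition cert :: "complex \<Rightarrow> complex \<Rightarrow> complex \<Rightarrow> nat \<Rightarrow> complex" where
  "cert a b n k =
     cert_poly a b n (of_nat k) /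
       ((b - 3 * n - 1) * (b - 3 * n) * (b - 3 * n + 1) * (a + 2 * n + of_nat k))"

lemma cert_0: "cert a b n 0 = - g1 a b n"
  by (simp add: cert_def cert_poly_def g1_def)

lemma cert_telescopes:
  assumes n: "n \<notin> \<int>\<^sub>\<le>\<^sub>0" and c: "a + 2 * n \<notin> \<int>\<^sub>\<le>\<^sub>0"
    and D: "(b - 3 * n - 1) * (b - 3 * n) * (b - 3 * n + 1) \<noteq> 0"
  shows "cert a b n (Suc k) * f_term a b n (Suc k) - cert a b n k * f_term a b n k =
         f_term a b n k - g2 a b n * f_term a b (n + 1) k"
proof -
  define c x D where "c = a + 2 * n" and "x = (of_nat k :: complex)"
    and "D = (b - 3 * n - 1) * (b - 3 * n) * (b - 3 * n + 1)"
  define M where "M = 2 * (2 * n + 1) * (a - n) * (n - b) * (a - b + 2 * n) * (a - b + 2 * n + 1)"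
  define F where "F = f_term a b n k"
  define P where "P = (n + x) * (c + x) * (c + x + 1)"
  have nz: "n + of_nat j \<noteq> 0" "c + of_nat j \<noteq> 0" for j
    using add_of_nat_nonzero[OF n] add_of_nat_nonzero[OF c] by (auto simp: c_def)
  have nx: "n + x \<noteq> 0" and cx: "c + x \<noteq> 0" and cx1: "c + x + 1 \<noteq> 0" 
    and c0: "c \<noteq> 0" and c1: "c + 1 \<noteq> 0" and D0: "D \<noteq> 0"
    using nz(1)[of k] nz(2)[of k] nz(2)[of "Suc k"] nz(2)[of 0] nz(2)[of 1] D
    by (auto simp: add_ac x_def D_def)
  have P0: "P \<noteq> 0"
    using nx cx cx1 by (simp add: P_def)
  \<comment> \<open>Each of the four terms is \<open>F / (D * P)\<close> times a polynomial in \<open>x\<close>.\<close>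
  have "cert a b n (Suc k) * f_term a b n (Suc k) =
        cert_poly a b n (x + 1) / (D * (c + x + 1)) * (F * ((a + x) * (b + x)) / ((n + x) * (c + x)))"
    by (simp add: cert_def f_term_Suc F_def x_def c_def D_def add_ac)
  also have "\<dots> = F / (D * P) * ((a + x) * (b + x) * cert_poly a b n (x + 1))"
    by (simp add: P_def mult_ac)
  finally have 1: "cert a b n (Suc k) * f_term a b n (Suc k) = \<dots>" .
  have "cert a b n k * f_term a b n k = cert_poly a b n x / (D * (c + x)) * F"
    by (simp add: cert_def F_def x_def c_def D_def)
  also have "\<dots> = F / (D * P) * ((n + x) * (c + x + 1) * cert_poly a b n x)"
    using nx cx cx1 D0 by (simp add: P_def divide_simps)
  finally have 2: "cert a b n k * f_term a b n k = \<dots>" .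
  have "g2 a b n * f_term a b (n + 1) k = M / (c * (c + 1) * D) * (F * (n * c * (c + 1)) / P)"
    using f_term_plus_one[OF n c, of b k]
    by (simp add: g2_def M_def F_def P_def x_def c_def D_def mult.assoc)
  also have "\<dots> = F / (D * P) * (n * M)"
    using c0 c1 D0 P0 by (simp add: divide_simps)
  finally have 3: "g2 a b n * f_term a b (n + 1) k = \<dots>" .
  have 4: "F = F / (D * P) * (D * P)"
    using D0 P0 by simp
  have key: "(a + x) * (b + x) * cert_poly a b n (x + 1) - (n + x) * (c + x + 1) * cert_poly a b n x
      = D * P - n * M"
    using cert_poly_identity[of a x b n] by (simp only: c_def D_def P_def M_def)
  have "cert a b n (Suc k) * f_term a b n (Suc k) - cert a b n k * f_term a b n k
      = F / (D * P) * (D * P - n * M)"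
    unfolding 1 2 right_diff_distrib[symmetric] key ..
  also have "\<dots> = F - g2 a b n * f_term a b (n + 1) k"
    unfolding 3 right_diff_distrib using 4 by simp
  finally show ?thesis
    by (simp add: F_def)
qed

lemma cert_over_of_nat_tendsto:
  assumes D: "(b - 3 * n - 1) * (b - 3 * n) * (b - 3 * n + 1) \<noteq> 0"
  shows "(\<lambda>k. cert a b n k / of_nat k) \<longlonglongrightarrow> 1 / (b - 3 * n + 1)"
proof -
  define c D where "c = a + 2 * n" and "D = (b - 3 * n - 1) * (b - 3 * n) * (b - 3 * n + 1)"
  define q1 where "q1 = (b - 3 * n - 1) *
         ((2 * a + 5 * n + 1) * (b - 3 * n + 1)
          - (1 + 2 * a + 2 * b + a * b - n * (a + 2 * n + 1)))"
  define q2 where "q2 = (b - 3 * n - 1) * (b - 3 * n)"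
  have inv: "(\<lambda>k. inverse (of_nat k) :: complex) \<longlonglongrightarrow> 0"
    by (rule lim_inverse_n)
  have "(\<lambda>k. (q2 + q1 * inverse (of_nat k) - N_poly a b n * inverse (of_nat k) ^ 2) /
             (D * (c * inverse (of_nat k) + 1)))
        \<longlonglongrightarrow> (q2 + q1 * 0 - N_poly a b n * 0 ^ 2) / (D * (c * 0 + 1))"
    using D by (intro tendsto_intros inv) (simp add: D_def)
  also have "(q2 + q1 * 0 - N_poly a b n * 0 ^ 2) / (D * (c * 0 + 1)) = 1 / (b - 3 * n + 1)"
    using D by (simp add: q2_def D_def)
  finally show ?thesis
  proof (rule Lim_transform_eventually)
    show "eventually (\<lambda>k. (q2 + q1 * inverse (of_nat k) - N_poly a b n * inverse (of_nat k) ^ 2) /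
             (D * (c * inverse (of_nat k) + 1)) = cert a b n k / of_nat k) sequentially"
      using eventually_gt_at_top[of 0]
    proof eventually_elim
      case (elim k)
      define x where "x = (of_nat k :: complex)"
      have x: "x \<noteq> 0"
        using elim by (simp add: x_def)
      have "(q2 + q1 * inverse x - N_poly a b n * inverse x ^ 2) / (D * (c * inverse x + 1)) =
          (x^2 * (q2 + q1 * inverse x - N_poly a b n * inverse x ^ 2)) /
          (x^2 * (D * (c * inverse x + 1)))"
        using x by simp
      also have "x^2 * (q2 + q1 * inverse x - N_poly a b n * inverse x ^ 2) = cert_poly a b n x"
        using x by (simp add: cert_poly_def q1_def q2_def field_simps power2_eq_square)
      also have "x^2 * (D * (c * inverse x + 1)) = D * (c + x) * x"
        using x by (simp add: field_simps power2_eq_square)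
      also have "cert_poly a b n x / (D * (c + x) * x) = cert a b n k / x"
        by (simp add: cert_def x_def c_def D_def)
      finally show ?case
        by (simp add: x_def)
    qed
  qed
qed

section \<open>Summation\<close>

theorem theorem4p32:
  fixes a b n :: complex
  assumes "n \<notin> \<int>\<^sub>\<le>\<^sub>0"
    and "a + 2 * n \<notin> \<int>\<^sub>\<le>\<^sub>0"
    and "summable (f_term a b n)"
    and "summable (f_term a b (n + 1))"
    and "(b - 3 * n - 1) * (b - 3 * n) * (b - 3 * n + 1) \<noteq> 0"
  shows "f_series a b n = g1 a b n + g2 a b n * f_series a b (n + 1)"
proof -
  let ?G = "\<lambda>k. cert a b n k * f_term a b n k"
  have tele: "(\<lambda>k. ?G (Suc k) - ?G k) = (\<lambda>k. f_term a b n k - g2 a b n * f_term a b (n + 1) k)"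
    using cert_telescopes[OF assms(1,2,5)] by blast
  have "summable (\<lambda>k. ?G (Suc k) - ?G k)"
    unfolding tele by (intro summable_diff summable_mult assms)
  then have "convergent (\<lambda>m. ?G m - ?G 0)"
    by (simp only: summable_iff_convergent sum_lessThan_telescope[of ?G])
  then obtain L where L: "?G \<longlonglongrightarrow> L"
    unfolding convergent_diff_const_right_iff by (auto simp: convergent_def)
  have ratio: "(\<lambda>k. cert a b n k / of_nat k) \<longlonglongrightarrow> 1 / (b - 3 * n + 1)"
    using assms(5) by (rule cert_over_of_nat_tendsto)
  have nz: "1 / (b - 3 * n + 1) \<noteq> 0"
    using assms(5) by simp
  have "(\<lambda>k. ?G k / (cert a b n k / of_nat k)) \<longlonglongrightarrow> L / (1 / (b - 3 * n + 1))"
    by (intro tendsto_divide L ratio nz)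
  moreover have "eventually (\<lambda>k. ?G k / (cert a b n k / of_nat k) = of_nat k * f_term a b n k) sequentially"
    using tendsto_imp_eventually_ne[OF ratio nz] by eventually_elim auto
  ultimately have "(\<lambda>k. of_nat k * f_term a b n k) \<longlonglongrightarrow> L / (1 / (b - 3 * n + 1))"
    by (rule Lim_transform_eventually)
  with assms(3) have "L / (1 / (b - 3 * n + 1)) = 0"
    by (rule summable_imp_limit_of_nat_mult_eq_0)
  with nz have "L = 0"
    by simp
  with L have "?G \<longlonglongrightarrow> 0"
    by simp
  then have "(\<lambda>k. ?G (Suc k) - ?G k) sums (0 - ?G 0)"
    by (rule telescope_sums)
  moreover have "?G 0 = - g1 a b n"
    by (simp add: cert_0 f_term_def)
  ultimately have "(\<lambda>k. f_term a b n k - g2 a b n * f_term a b (n + 1) k) sums g1 a b n"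
    unfolding tele by simp
  moreover have "(\<lambda>k. f_term a b n k - g2 a b n * f_term a b (n + 1) k) sums
      (f_series a b n - g2 a b n * f_series a b (n + 1))"
    unfolding f_series_def by (intro sums_diff sums_mult summable_sums assms)
  ultimately have "f_series a b n - g2 a b n * f_series a b (n + 1) = g1 a b n"
    by (rule sums_unique2[symmetric])
  then show ?thesis
    by (simp add: algebra_simps)
qed

end
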